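(* Let $d\ge1$. The space of GIT stability conditions $\mathrm{Stab}(1,d,2)$ for triples $(C,L_1,L_2)$ consisting of a plane curve $C$ of degree $d$ and two (labeled) lines is $$\mathrm{Stab}(1,d,2)=\{(t_1,t_2)\in\mathbb Q^2 \mid 2t_1-t_2-d\le0,\ 2t_2-t_1-d\le0,\ 0\le t_1,\ 0\le t_2\}.$$ In particular, $(1,1)\in\mathrm{Stab}(1,d,2)$.
   Context: Work over $\mathbb C$. Let $C=\{f=0\}$, $L_i=\{l_i=0\}$ in $\mathbb P^2$ with coordinates $x_0,x_1,x_2$, and $G=\mathrm{SL}_3$. A normalized one-parameter subgroup is $\lambda(s)=\mathrm{Diag}(s^{r_0},s^{r_1},s^{r_2})$ with $r_i\in\mathbb Z$, $r_0+r_1+r_2=0$, $r_0\ge r_1\ge r_2$, not all zero. For a nonzero homogeneous polynomial $g$ put $\mu(g,\lambda)=\min\{\sum d_ir_i : x_0^{d_0}x_1^{d_1}x_2^{d_2}\text{ occurs in }g\}$. For $\vec t=(t_1,t_2)\in(\mathbb Q_{\ge0})^2$ put $\mu_{\vec t}((f,l_1,l_2),\lambda)=\mu(f,\lambda)+t_1\mu(l_1,\lambda)+t_2\mu(l_2,\lambda)$. The triple is $\vec t$-semistable if $\mu_{\vec t}(g\cdot(f,l_1,l_2),\lambda)\le0$ for all $g\in G$ and all normalized $\lambda$. $\mathrm{Stab}(1,d,2)$ is the set of $\vec t\in(\mathbb Q_{\ge0})^2$ for which some $\vec t$-semistable triple $(C,L_1,L_2)$ exists.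
   Formalization: For d = 1 the printed equality fails: (0,0) satisfies the inequalities, but no triple is (0,0)-semistable because C is a line. The equality is proved for d ≥ 2; for d = 1, Stab(1,1,2) = {(1,1)} is proved instead; (1,1) ∈ Stab(1,d,2) is proved for all d ≥ 1. *)

theory Defs
  imports "HOL-Analysis.Analysis" "HOL-Library.Poly_Mapping"
begin

text \<open>
  The ring \<open>\<complex>[x\<^sub>0, x\<^sub>1, x\<^sub>2]\<close>: finitely supported maps from exponent vectors to coefficients, with
  the convolution product of \<^theory>\<open>HOL-Library.Poly_Mapping\<close>. The variables are indexed by the
  three elements \<open>0\<close>, \<open>1\<close>, \<open>2\<close> of the type \<^typ>\<open>3\<close> (in which \<open>3 = 0\<close>).
\<close>

type_synonym monomial = "3 \<Rightarrow>\<^sub>0 nat"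
type_synonym ternary_poly = "monomial \<Rightarrow>\<^sub>0 complex"

definition Var :: "3 \<Rightarrow> ternary_poly" where
  "Var i = Poly_Mapping.single (Poly_Mapping.single i 1) 1"

definition Const :: "complex \<Rightarrow> ternary_poly" where
  "Const c = Poly_Mapping.single 0 c"

definition mon_degree :: "monomial \<Rightarrow> nat" where
  "mon_degree m = (\<Sum>i\<in>UNIV. Poly_Mapping.lookup m i)"

text \<open>
  Nonzero forms of degree \<open>d\<close>. A plane curve of degree \<open>d\<close> (possibly reducible or non-reduced) is
  given by such a form, a line by one of degree 1. Rescaling a form does not change its set of
  monomials, so nothing below depends on the choice of the equation.
\<close>

definition is_form :: "nat \<Rightarrow> ternary_poly \<Rightarrow> bool" where
  "is_form d p \<longleftrightarrow> p \<noteq> 0 \<and> (\<forall>m\<in>Poly_Mapping.keys p. mon_degree m = d)"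

definition subst_poly :: "(3 \<Rightarrow> ternary_poly) \<Rightarrow> ternary_poly \<Rightarrow> ternary_poly" where
  "subst_poly q p = (\<Sum>m\<in>Poly_Mapping.keys p. Const (Poly_Mapping.lookup p m) * (\<Prod>i\<in>UNIV. q i ^ Poly_Mapping.lookup m i))"

definition SL3 :: "(complex^3^3) set" where
  "SL3 = {g. det g = 1}"

text \<open>The left action \<open>(g \<cdot> p)(x) = p(g\<^sup>-\<^sup>1 x)\<close>.\<close>

definition act :: "complex^3^3 \<Rightarrow> ternary_poly \<Rightarrow> ternary_poly" where
  "act g p = subst_poly (\<lambda>i. \<Sum>j\<in>UNIV. Const (matrix_inv g $ i $ j) * Var j) p"

text \<open>
  The one-parameter subgroup \<open>\<lambda>(s) = Diag(s\<^bsup>r 0\<^esup>, s\<^bsup>r 1\<^esup>, s\<^bsup>r 2\<^esup>)\<close> is represented by its weight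
  vector \<open>r\<close>.
\<close>

definition normalized_1ps :: "(3 \<Rightarrow> int) \<Rightarrow> bool" where
  "normalized_1ps r \<longleftrightarrow>
     r 0 + r 1 + r 2 = 0 \<and> r 0 \<ge> r 1 \<and> r 1 \<ge> r 2 \<and> (\<exists>i. r i \<noteq> 0)"

definition mon_weight :: "(3 \<Rightarrow> int) \<Rightarrow> monomial \<Rightarrow> int" where
  "mon_weight r m = (\<Sum>i\<in>UNIV. int (Poly_Mapping.lookup m i) * r i)"

text \<open>Only meaningful for \<open>p \<noteq> 0\<close>, where the set of occurring monomials is nonempty.\<close>

definition hm_weight :: "ternary_poly \<Rightarrow> (3 \<Rightarrow> int) \<Rightarrow> int" where
  "hm_weight p r = Min (mon_weight r ` Poly_Mapping.keys p)"

definition hm_weight_t ::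
  "rat \<times> rat \<Rightarrow> ternary_poly \<Rightarrow> ternary_poly \<Rightarrow> ternary_poly \<Rightarrow> (3 \<Rightarrow> int) \<Rightarrow> rat" where
  "hm_weight_t t f l1 l2 r =
     of_int (hm_weight f r) + fst t * of_int (hm_weight l1 r) + snd t * of_int (hm_weight l2 r)"

definition t_semistable ::
  "rat \<times> rat \<Rightarrow> ternary_poly \<Rightarrow> ternary_poly \<Rightarrow> ternary_poly \<Rightarrow> bool" where
  "t_semistable t f l1 l2 \<longleftrightarrow>
     (\<forall>g\<in>SL3. \<forall>r. normalized_1ps r \<longrightarrow> hm_weight_t t (act g f) (act g l1) (act g l2) r \<le> 0)"

text \<open>
  \<open>Stab d\<close> is the set of stability conditions written Stab(1,d,2) in the literature. The
  degree \<open>d = 1\<close> is degenerate: then \<open>f\<close> is itself a line, so taking it to \<open>x\<^sub>0\<close> and using the weights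
  \<open>(2, -1, -1)\<close> gives the further necessary condition \<open>t\<^sub>1 + t\<^sub>2 \<ge> 2\<close>, which excludes for instance
  \<open>(0, 0)\<close>. Together with \<open>2 t\<^sub>1 - t\<^sub>2 \<le> 1\<close> and \<open>2 t\<^sub>2 - t\<^sub>1 \<le> 1\<close> it leaves only \<open>(1, 1)\<close>.
\<close>

definition Stab :: "nat \<Rightarrow> (rat \<times> rat) set" where
  "Stab d = {(t1, t2). t1 \<ge> 0 \<and> t2 \<ge> 0 \<and>
     (\<exists>f l1 l2. is_form d f \<and> is_form 1 l1 \<and> is_form 1 l2 \<and> t_semistable (t1, t2) f l1 l2)}"

end

theory Submission
  imports Defs
begin

text \<open>
  Necessity: move a line to \<open>x\<^sub>0 = 0\<close> and use the weights \<open>(2, -1, -1)\<close>; the line has weight \<open>2\<close>, and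
  a form of degree \<open>e\<close> has weight at least \<open>-e\<close>.

  Sufficiency: \<open>\<mu>(\<cdot>, \<lambda>)\<close> is additive on products, so if \<open>f\<close> is a product of \<open>d\<close> lines, the triple behaves
  like \<open>d + 2\<close> lines of weights \<open>1, \<dots>, 1, t\<^sub>1, t\<^sub>2\<close> and total weight \<open>W = d + t\<^sub>1 + t\<^sub>2\<close>. If no three lines
  are concurrent, then in any coordinates at most one of them is \<open>x\<^sub>0 = 0\<close> and at most two do not
  involve \<open>x\<^sub>2\<close>. Hence the triple is semistable as soon as no single weight exceeds \<open>W / 3\<close>, which is
  the system of inequalities to be shown together with \<open>W \<ge> 3\<close>. For \<open>d \<ge> 2\<close> the latter only fails when
  \<open>d = 2\<close> and \<open>t\<^sub>1 + t\<^sub>2 < 1\<close>, where a smooth conic and a transversal line, taken twice, are semistable.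
\<close>

section \<open>Ternary polynomials\<close>

lemma three_eq_0: "(3::3) = 0"
  by simp

lemma UNIV_3': "(UNIV :: 3 set) = {0, 1, 2}"
  unfolding UNIV_3 three_eq_0 by blast

lemma distinct_3' [simp]:
  "(0::3) \<noteq> 1" "(1::3) \<noteq> 0" "(0::3) \<noteq> 2" "(2::3) \<noteq> 0" "(1::3) \<noteq> 2" "(2::3) \<noteq> 1"
  by simp_all

lemma sum_3': "(\<Sum>i\<in>UNIV. f (i::3)) = f 0 + f 1 + (f 2 :: 'a::comm_monoid_add)"
  unfolding sum_3 three_eq_0 by (simp only: ac_simps)

lemma forall_3': "(\<forall>i::3. P i) \<longleftrightarrow> P 0 \<and> P 1 \<and> P 2"
  unfolding forall_3 three_eq_0 by blast

lemma det_3':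
  "det (A::'a::comm_ring_1^3^3) =
     A$0$0 * (A$1$1 * A$2$2 - A$1$2 * A$2$1) - A$0$1 * (A$1$0 * A$2$2 - A$1$2 * A$2$0) +
     A$0$2 * (A$1$0 * A$2$1 - A$1$1 * A$2$0)"
  unfolding det_3 three_eq_0 by (simp add: algebra_simps)

lemma poly_mapping_sum_single:
  "p = (\<Sum>m\<in>Poly_Mapping.keys p. Poly_Mapping.single m (Poly_Mapping.lookup p m))"
proof (rule poly_mapping_eqI)
  fix k
  have "(\<Sum>m\<in>Poly_Mapping.keys p. Poly_Mapping.lookup p m when m = k) =
        (\<Sum>m\<in>Poly_Mapping.keys p. if m = k then Poly_Mapping.lookup p k else 0)"
    by (intro sum.cong) (auto simp: when_def)
  also have "\<dots> = Poly_Mapping.lookup p k"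
    by (simp add: in_keys_iff)
  finally show "Poly_Mapping.lookup p k =
      Poly_Mapping.lookup (\<Sum>m\<in>Poly_Mapping.keys p. Poly_Mapping.single m (Poly_Mapping.lookup p m)) k"
    by (simp add: lookup_sum lookup_single)
qed

lemma Const_0 [simp]: "Const 0 = 0"
  and Const_1 [simp]: "Const 1 = 1"
  and Const_add: "Const (a + b) = Const a + Const b"
  and Const_mult: "Const (a * b) = Const a * Const b"
  by (simp_all add: Const_def single_add mult_single)

lemma Const_sum: "Const (\<Sum>i\<in>A. f i) = (\<Sum>i\<in>A. Const (f i))"
  by (induction A rule: infinite_finite_induct) (simp_all add: Const_add)

lemma poly_mapping_mult_eq_sum:
  fixes p q :: "'a::comm_monoid_add \<Rightarrow>\<^sub>0 'b::comm_semiring_1"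
  shows "p * q = (\<Sum>m\<in>Poly_Mapping.keys p. \<Sum>n\<in>Poly_Mapping.keys q.
    Poly_Mapping.single (m + n) (Poly_Mapping.lookup p m * Poly_Mapping.lookup q n))"
proof -
  have "p * q = (\<Sum>m\<in>Poly_Mapping.keys p. Poly_Mapping.single m (Poly_Mapping.lookup p m)) *
      (\<Sum>n\<in>Poly_Mapping.keys q. Poly_Mapping.single n (Poly_Mapping.lookup q n))"
    by (rule arg_cong2[where f = "(*)", OF poly_mapping_sum_single poly_mapping_sum_single])
  then show ?thesis by (simp only: sum_product mult_single)
qed

section \<open>Substitution and the action\<close>

definition mon_subst :: "(3 \<Rightarrow> ternary_poly) \<Rightarrow> monomial \<Rightarrow> ternary_poly" where
  "mon_subst q m = (\<Prod>i\<in>UNIV. q i ^ Poly_Mapping.lookup m i)"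

lemma mon_subst_0 [simp]: "mon_subst q 0 = 1"
  by (simp add: mon_subst_def)

lemma mon_subst_add: "mon_subst q (m + n) = mon_subst q m * mon_subst q n"
  by (simp add: mon_subst_def lookup_add power_add prod.distrib)

lemma mon_subst_single: "mon_subst q (Poly_Mapping.single i 1) = q i"
proof -
  have "mon_subst q (Poly_Mapping.single i 1) = (\<Prod>j\<in>UNIV. if i = j then q j else 1)"
    unfolding mon_subst_def by (intro prod.cong) (auto simp: lookup_single when_def)
  then show ?thesis by simp
qed

text \<open>Terms may cancel in a sum, so \<open>p\<close>, \<open>p'\<close> and
  \<open>p + p'\<close> have different keys; over a common finite index set additivity becomes a
  termwise computation.\<close>

lemma subst_poly_superset:
  assumes "finite S" "Poly_Mapping.keys p \<subseteq> S"
  shows "subst_poly q p = (\<Sum>m\<in>S. Const (Poly_Mapping.lookup p m) * mon_subst q m)"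
  unfolding subst_poly_def mon_subst_def[symmetric]
  using assms by (intro sum.mono_neutral_left) (auto simp: in_keys_iff)

lemma subst_poly_0 [simp]: "subst_poly q 0 = 0"
  by (simp add: subst_poly_def)

lemma subst_poly_add: "subst_poly q (p + p') = subst_poly q p + subst_poly q p'"
proof -
  let ?S = "Poly_Mapping.keys p \<union> Poly_Mapping.keys p'"
  have "Poly_Mapping.keys (p + p') \<subseteq> ?S" by (rule keys_add)
  then show ?thesis
    by (simp add: subst_poly_superset[of ?S] lookup_add Const_add distrib_right sum.distrib)
qed

lemma subst_poly_sum: "subst_poly q (\<Sum>i\<in>A. p i) = (\<Sum>i\<in>A. subst_poly q (p i))"
  by (induction A rule: infinite_finite_induct) (simp_all add: subst_poly_add)

lemma subst_poly_single: "subst_poly q (Poly_Mapping.single m c) = Const c * mon_subst q m"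
  by (subst subst_poly_superset[of "{m}"]) auto

lemma subst_poly_Const [simp]: "subst_poly q (Const c) = Const c"
  by (simp add: Const_def[of c] subst_poly_single)

lemma subst_poly_Var [simp]: "subst_poly q (Var i) = q i"
  using mon_subst_single[of q i] by (simp add: Var_def subst_poly_single)

lemma subst_poly_mult: "subst_poly q (p * p') = subst_poly q p * subst_poly q p'"
proof -
  let ?K = "Poly_Mapping.keys p" and ?K' = "Poly_Mapping.keys p'"
  have "p * p' = (\<Sum>m\<in>?K. \<Sum>n\<in>?K'.
      Poly_Mapping.single (m + n) (Poly_Mapping.lookup p m * Poly_Mapping.lookup p' n))"
    by (rule poly_mapping_mult_eq_sum)
  then have "subst_poly q (p * p') = (\<Sum>m\<in>?K. \<Sum>n\<in>?K'.
      (Const (Poly_Mapping.lookup p m) * mon_subst q m) * (Const (Poly_Mapping.lookup p' n) * mon_subst q n))"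
    by (simp add: subst_poly_sum subst_poly_single Const_mult mon_subst_add ac_simps)
  also have "\<dots> = subst_poly q p * subst_poly q p'"
    by (simp add: sum_product subst_poly_def mon_subst_def)
  finally show ?thesis .
qed

lemma subst_poly_1 [simp]: "subst_poly q 1 = 1"
  using subst_poly_Const[of q 1] by simp

lemma subst_poly_power: "subst_poly q (p ^ n) = subst_poly q p ^ n"
  by (induction n) (simp_all add: subst_poly_mult)

lemma subst_poly_prod: "subst_poly q (\<Prod>i\<in>A. p i) = (\<Prod>i\<in>A. subst_poly q (p i))"
  by (induction A rule: infinite_finite_induct) (simp_all add: subst_poly_mult)

text \<open>Substitution is a ring homomorphism fixing the constants, so the outer one can be
  carried into each term of the inner one.\<close>

lemma subst_poly_subst_poly: "subst_poly q (subst_poly q' p) = subst_poly (\<lambda>i. subst_poly q (q' i)) p"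
  by (simp add: subst_poly_def[of q' p] subst_poly_sum subst_poly_mult subst_poly_prod subst_poly_power)
    (simp add: subst_poly_def)

lemma subst_poly_Var_id: "subst_poly Var p = p"
proof -
  have "mon_subst Var m = Poly_Mapping.single m 1" for m
  proof -
    have "Var i ^ n = Poly_Mapping.single (Poly_Mapping.single i n) 1" for i n
      by (induction n) (simp_all add: Var_def mult_single single_add[symmetric])
    then have "mon_subst Var m =
        (\<Prod>i\<in>UNIV. Poly_Mapping.single (Poly_Mapping.single i (Poly_Mapping.lookup m i)) 1)"
      by (simp add: mon_subst_def)
    also have "\<dots> = Poly_Mapping.single (\<Sum>i\<in>UNIV. Poly_Mapping.single i (Poly_Mapping.lookup m i)) 1"
      unfolding sum_3' UNIV_3' by (simp add: mult_single ac_simps)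
    also have "(\<Sum>i\<in>UNIV. Poly_Mapping.single i (Poly_Mapping.lookup m i)) = m"
    proof -
      have "(\<Sum>i\<in>UNIV. Poly_Mapping.single i (Poly_Mapping.lookup m i)) =
            (\<Sum>i\<in>Poly_Mapping.keys m. Poly_Mapping.single i (Poly_Mapping.lookup m i))"
        by (intro sum.mono_neutral_right) (auto simp: in_keys_iff)
      then show ?thesis by (simp only: poly_mapping_sum_single[symmetric])
    qed
    finally show ?thesis .
  qed
  then have "subst_poly Var p =
      (\<Sum>m\<in>Poly_Mapping.keys p. Poly_Mapping.single m (Poly_Mapping.lookup p m))"
    by (simp add: subst_poly_def mon_subst_def[symmetric] Const_def mult_single)
  then show ?thesis by (simp only: poly_mapping_sum_single[symmetric])
qed

section \<open>Linear forms and the action on them\<close>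

definition lin :: "(3 \<Rightarrow> complex) \<Rightarrow> ternary_poly" where
  "lin v = (\<Sum>j\<in>UNIV. Const (v j) * Var j)"

lemma lin_eq_single: "lin v = (\<Sum>j\<in>UNIV. Poly_Mapping.single (Poly_Mapping.single j 1) (v j))"
  by (simp add: lin_def Const_def Var_def mult_single)

lemma single_1_eq_iff:
  "Poly_Mapping.single i (1::nat) = Poly_Mapping.single j 1 \<longleftrightarrow> i = j"
  by (metis keys_single one_neq_zero singleton_inject)

lemma lookup_lin: "Poly_Mapping.lookup (lin v) (Poly_Mapping.single j 1) = v j"
proof -
  have "Poly_Mapping.lookup (lin v) (Poly_Mapping.single j 1) = (\<Sum>i\<in>UNIV. if i = j then v j else 0)"
    unfolding lin_eq_single lookup_sum
    by (intro sum.cong) (auto simp: lookup_single when_def single_1_eq_iff simp del: One_nat_def)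
  then show ?thesis by simp
qed

lemma keys_lin: "Poly_Mapping.keys (lin v) = (\<lambda>j. Poly_Mapping.single j 1) ` {j. v j \<noteq> 0}"
proof
  show "Poly_Mapping.keys (lin v) \<subseteq> (\<lambda>j. Poly_Mapping.single j 1) ` {j. v j \<noteq> 0}"
    unfolding lin_eq_single using keys_sum by (fastforce split: if_splits)
  show "(\<lambda>j. Poly_Mapping.single j 1) ` {j. v j \<noteq> 0} \<subseteq> Poly_Mapping.keys (lin v)"
    by (auto simp: in_keys_iff lookup_lin simp del: One_nat_def)
qed

lemma lin_eq_0_iff: "lin v = 0 \<longleftrightarrow> (\<forall>j. v j = 0)"
  using keys_lin[of v] keys_eq_empty by auto

lemma Var_eq_lin: "Var i = lin (\<lambda>j. if i = j then 1 else 0)"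
proof -
  have "lin (\<lambda>j. if i = j then 1 else 0) = (\<Sum>j\<in>UNIV. if i = j then Var j else 0)"
    unfolding lin_def by (intro sum.cong) auto
  then show ?thesis by simp
qed

lemma act_eq: "act g p = subst_poly (\<lambda>i. lin (\<lambda>j. matrix_inv g $ i $ j)) p"
  by (simp add: act_def lin_def)

lemma act_add: "act g (p + q) = act g p + act g q"
  and act_mult: "act g (p * q) = act g p * act g q"
  and act_power: "act g (p ^ n) = act g p ^ n"
  and act_prod: "act g (\<Prod>i\<in>A. f i) = (\<Prod>i\<in>A. act g (f i))"
  by (simp_all add: act_eq subst_poly_add subst_poly_mult subst_poly_power subst_poly_prod)

text \<open>On coefficients this is the product of the row vector \<open>v\<close> with the matrix
  \<open>A\<close>; hence \<open>act g\<close> multiplies \<open>v\<close> by the inverse of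
  \<open>g\<close> from the right.\<close>

lemma subst_poly_lin:
  "subst_poly (\<lambda>i. lin (A i)) (lin v) = lin (\<lambda>j. \<Sum>i\<in>UNIV. v i * A i j)"
proof -
  have "subst_poly (\<lambda>i. lin (A i)) (lin v) = (\<Sum>i\<in>UNIV. Const (v i) * lin (A i))"
    by (simp add: lin_def[of v] subst_poly_sum subst_poly_mult)
  also have "\<dots> = (\<Sum>i\<in>UNIV. \<Sum>j\<in>UNIV. Const (v i * A i j) * Var j)"
    by (simp add: lin_def sum_distrib_left Const_mult mult.assoc)
  also have "\<dots> = lin (\<lambda>j. \<Sum>i\<in>UNIV. v i * A i j)"
    by (subst sum.swap) (simp add: lin_def Const_sum sum_distrib_right)
  finally show ?thesis .
qed

lemma act_lin: "act g (lin v) = lin (\<lambda>j. \<Sum>i\<in>UNIV. v i * matrix_inv g $ i $ j)"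
  by (simp add: act_eq subst_poly_lin)

lemma act_Var: "act g (Var i) = lin (\<lambda>j. matrix_inv g $ i $ j)"
  by (simp add: act_eq)

lemma SL3_matrix_inv:
  assumes "g \<in> SL3"
  shows "g ** matrix_inv g = mat 1" "matrix_inv g ** g = mat 1" "det (matrix_inv g) = 1"
proof -
  have "invertible g" using assms by (simp add: SL3_def invertible_det_nz)
  then have "g ** matrix_inv g = mat 1 \<and> matrix_inv g ** g = mat 1"
    unfolding invertible_def matrix_inv_def by (rule someI_ex)
  then show 1: "g ** matrix_inv g = mat 1" "matrix_inv g ** g = mat 1"
    by simp_all
  have "det g * det (matrix_inv g) = 1"
    using arg_cong[OF 1(1), of det] by (simp add: det_mul det_I)
  then show "det (matrix_inv g) = 1" using assms by (simp add: SL3_def)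
qed

text \<open>Substituting the rows of \<open>g\<close> itself undoes \<open>act g\<close>, so the
  action is injective.\<close>

lemma act_eq_0_iff:
  assumes "g \<in> SL3"
  shows "act g p = 0 \<longleftrightarrow> p = 0"
proof
  assume "act g p = 0"
  have "(\<Sum>k\<in>UNIV. matrix_inv g $ i $ k * g $ k $ j) = (if i = j then 1 else 0)" for i j
    using arg_cong[OF SL3_matrix_inv(2)[OF assms], of "\<lambda>A. A $ i $ j"]
    by (simp add: matrix_matrix_mult_def mat_def)
  then have "subst_poly (\<lambda>i. lin (\<lambda>j. g $ i $ j)) (lin (\<lambda>j. matrix_inv g $ i $ j)) = Var i" for i
    by (simp add: subst_poly_lin Var_eq_lin)
  then have "subst_poly (\<lambda>i. lin (\<lambda>j. g $ i $ j)) (act g p) = p"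
    by (simp add: act_eq subst_poly_subst_poly subst_poly_Var_id)
  then show "p = 0" using \<open>act g p = 0\<close> by simp
qed (simp add: act_eq)

section \<open>Forms\<close>

text \<open>Unlike \<open>is_form\<close> this admits the zero polynomial, which makes it stable
  under sums; nonvanishing is tracked separately.\<close>

definition homog :: "nat \<Rightarrow> ternary_poly \<Rightarrow> bool" where
  "homog d p \<longleftrightarrow> (\<forall>m\<in>Poly_Mapping.keys p. mon_degree m = d)"

lemma is_form_iff: "is_form d p \<longleftrightarrow> p \<noteq> 0 \<and> homog d p"
  by (simp add: is_form_def homog_def)

lemma mon_degree_add: "mon_degree (m + n) = mon_degree m + mon_degree n"
  by (simp add: mon_degree_def lookup_add sum.distrib)

lemma mon_degree_single: "mon_degree (Poly_Mapping.single i n) = n"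
proof -
  have "mon_degree (Poly_Mapping.single i n) = (\<Sum>j\<in>UNIV. if i = j then n else 0)"
    unfolding mon_degree_def by (intro sum.cong) (auto simp: lookup_single when_def)
  then show ?thesis by simp
qed

lemma homog_Const: "homog 0 (Const c)"
  by (simp add: homog_def Const_def mon_degree_def)

lemma homog_mult: "homog d p \<Longrightarrow> homog e q \<Longrightarrow> homog (d + e) (p * q)"
  unfolding homog_def using keys_mult[of p q] by (fastforce simp: mon_degree_add)

lemma homog_add: "homog d p \<Longrightarrow> homog d q \<Longrightarrow> homog d (p + q)"
  unfolding homog_def using keys_add[of p q] by blast

lemma homog_sum: "(\<And>i. i \<in> A \<Longrightarrow> homog d (p i)) \<Longrightarrow> homog d (\<Sum>i\<in>A. p i)"
  unfolding homog_def using keys_sum[of p A] by blast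

lemma homog_power: "homog d p \<Longrightarrow> homog (n * d) (p ^ n)"
proof (induction n)
  case 0
  then show ?case using homog_Const[of 1] by simp
qed (simp add: homog_mult)

lemma homog_prod: "(\<And>i. i \<in> A \<Longrightarrow> homog (e i) (p i)) \<Longrightarrow> homog (\<Sum>i\<in>A. e i) (\<Prod>i\<in>A. p i)"
proof (induction A rule: infinite_finite_induct)
  case (insert x F)
  then show ?case by (simp add: homog_mult)
qed (use homog_Const[of 1] in simp_all)

lemma homog_lin: "homog 1 (lin v)"
  by (auto simp: homog_def keys_lin mon_degree_single simp del: One_nat_def)

lemma is_form_lin: "v i \<noteq> 0 \<Longrightarrow> is_form 1 (lin v)"
  using homog_lin lin_eq_0_iff by (auto simp: is_form_iff)

lemma is_form_Var: "is_form 1 (Var i)"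
  unfolding Var_eq_lin by (rule is_form_lin[of _ i]) simp

text \<open>Every variable is replaced by a linear form, so a monomial of degree \<open>d\<close>
  becomes a product of \<open>d\<close> linear forms.\<close>

lemma homog_act:
  assumes "homog d p"
  shows "homog d (act g p)"
proof -
  have "homog (0 + (\<Sum>i\<in>UNIV. Poly_Mapping.lookup m i * 1))
      (Const c * (\<Prod>i\<in>UNIV. lin (\<lambda>j. matrix_inv g $ i $ j) ^ Poly_Mapping.lookup m i))" for c m
    by (intro homog_mult homog_Const homog_prod homog_power homog_lin)
  with assms show ?thesis
    unfolding act_eq subst_poly_def by (intro homog_sum) (simp add: homog_def mon_degree_def)
qed

lemma is_form_act: "g \<in> SL3 \<Longrightarrow> is_form d p \<Longrightarrow> is_form d (act g p)"
  by (simp add: is_form_iff homog_act act_eq_0_iff)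

lemma mon_degree_1:
  assumes "mon_degree m = 1"
  shows "\<exists>i. m = Poly_Mapping.single i 1"
proof -
  have "\<exists>i. Poly_Mapping.lookup m i = 1 \<and> (\<forall>j. j \<noteq> i \<longrightarrow> Poly_Mapping.lookup m j = 0)"
    using assms unfolding mon_degree_def by (subst (asm) sum_eq_1_iff) auto
  then obtain i where "Poly_Mapping.lookup m i = 1" "\<And>j. j \<noteq> i \<Longrightarrow> Poly_Mapping.lookup m j = 0"
    by auto
  then have "m = Poly_Mapping.single i 1"
    by (intro poly_mapping_eqI) (auto simp: lookup_single when_def)
  then show ?thesis ..
qed

lemma is_form_1_obtains:
  assumes "is_form 1 l"
  obtains v i where "l = lin v" "v i \<noteq> 0"
proof -
  define v where "v j = Poly_Mapping.lookup l (Poly_Mapping.single j 1)" for j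
  have "l = lin v"
  proof (rule poly_mapping_eqI)
    fix m
    show "Poly_Mapping.lookup l m = Poly_Mapping.lookup (lin v) m"
    proof (cases "mon_degree m = 1")
      case True
      then show ?thesis using mon_degree_1 lookup_lin by (metis v_def)
    next
      case False
      then have "m \<notin> Poly_Mapping.keys l" "m \<notin> Poly_Mapping.keys (lin v)"
        using assms homog_lin by (auto simp: is_form_iff homog_def)
      then show ?thesis by (simp add: in_keys_iff)
    qed
  qed
  moreover have "\<exists>i. v i \<noteq> 0"
    using assms lin_eq_0_iff calculation by (auto simp: is_form_iff)
  ultimately show ?thesis using that by blast
qed

section \<open>Hilbert-Mumford weights\<close>

lemma mon_weight_add: "mon_weight r (m + n) = mon_weight r m + mon_weight r n"
  by (simp add: mon_weight_def lookup_add sum.distrib distrib_right)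

lemma mon_weight_single: "mon_weight r (Poly_Mapping.single i 1) = r i"
proof -
  have "mon_weight r (Poly_Mapping.single i 1) = (\<Sum>j\<in>UNIV. if i = j then r j else 0)"
    unfolding mon_weight_def by (intro sum.cong) (auto simp: lookup_single when_def)
  then show ?thesis by simp
qed

lemma hm_weight_le: "m \<in> Poly_Mapping.keys p \<Longrightarrow> hm_weight p r \<le> mon_weight r m"
  unfolding hm_weight_def by (rule Min_le) auto

lemma hm_weight_ge:
  assumes "p \<noteq> 0" "\<And>m. m \<in> Poly_Mapping.keys p \<Longrightarrow> c \<le> mon_weight r m"
  shows "c \<le> hm_weight p r"
  unfolding hm_weight_def using assms by (subst Min_ge_iff) auto

lemma hm_weight_lin_le: "v i \<noteq> 0 \<Longrightarrow> hm_weight (lin v) r \<le> r i"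
  using hm_weight_le[of "Poly_Mapping.single i 1" "lin v" r] by (simp add: keys_lin mon_weight_single del: One_nat_def)

text \<open>
  Among the monomials of least weight take the lexicographically least one. The product of two such
  monomials arises from no other pair of monomials, so it occurs in the product of the polynomials.
\<close>

lemma hm_weight_mult_le:
  assumes "p \<noteq> 0" "q \<noteq> 0"
  shows "hm_weight (p * q) r \<le> hm_weight p r + hm_weight q r"
proof -
  have least: "\<exists>m\<in>Poly_Mapping.keys p. mon_weight r m = hm_weight p r \<and>
      (\<forall>n\<in>Poly_Mapping.keys p. mon_weight r n = hm_weight p r \<longrightarrow> m \<le> n)" if "p \<noteq> 0" for p
  proof -
    let ?M = "{m\<in>Poly_Mapping.keys p. mon_weight r m = hm_weight p r}"
    have "hm_weight p r \<in> mon_weight r ` Poly_Mapping.keys p"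
      unfolding hm_weight_def using that by (intro Min_in) auto
    then have "finite ?M" "?M \<noteq> {}" by auto
    then have "Min ?M \<in> ?M" "\<forall>n\<in>?M. Min ?M \<le> n" by (rule Min_in, simp)
    then show ?thesis by blast
  qed
  obtain a where a: "a \<in> Poly_Mapping.keys p" "mon_weight r a = hm_weight p r"
    and a_le: "\<And>n. n \<in> Poly_Mapping.keys p \<Longrightarrow> mon_weight r n = hm_weight p r \<Longrightarrow> a \<le> n"
    using least[OF assms(1)] by blast
  obtain b where b: "b \<in> Poly_Mapping.keys q" "mon_weight r b = hm_weight q r"
    and b_le: "\<And>n. n \<in> Poly_Mapping.keys q \<Longrightarrow> mon_weight r n = hm_weight q r \<Longrightarrow> b \<le> n"
    using least[OF assms(2)] by blast
  have uniq: "m = a \<and> n = b"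
    if "m \<in> Poly_Mapping.keys p" "n \<in> Poly_Mapping.keys q" "m + n = a + b" for m n
  proof -
    have "mon_weight r m + mon_weight r n = hm_weight p r + hm_weight q r"
      using that(3) a(2) b(2) by (metis mon_weight_add)
    with hm_weight_le[OF that(1), of r] hm_weight_le[OF that(2), of r]
    have "mon_weight r m = hm_weight p r" "mon_weight r n = hm_weight q r" by auto
    then have "a \<le> m" "b \<le> n" using a_le b_le that by auto
    then show ?thesis using that(3)
      by (metis add_le_cancel_left add_le_cancel_right antisym add.commute)
  qed
  have "Poly_Mapping.lookup (p * q) (a + b) =
      (\<Sum>m\<in>Poly_Mapping.keys p. \<Sum>n\<in>Poly_Mapping.keys q.
        Poly_Mapping.lookup p m * Poly_Mapping.lookup q n when m + n = a + b)"
    by (simp add: poly_mapping_mult_eq_sum[of p q] lookup_sum lookup_single)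
  also have "\<dots> = (\<Sum>m\<in>Poly_Mapping.keys p. \<Sum>n\<in>Poly_Mapping.keys q.
        if n = b then (if m = a then Poly_Mapping.lookup p a * Poly_Mapping.lookup q b else 0) else 0)"
    by (intro sum.cong refl) (auto simp: when_def dest: uniq)
  also have "\<dots> = Poly_Mapping.lookup p a * Poly_Mapping.lookup q b"
    using a(1) b(1) by simp
  finally have "a + b \<in> Poly_Mapping.keys (p * q)"
    using a(1) b(1) by (simp add: in_keys_iff)
  from hm_weight_le[OF this, of r] show ?thesis by (simp add: mon_weight_add a b)
qed

text \<open>Semistability bounds weights from above, so this is the half of additivity to use. The
  empty product \<open>1\<close> has weight \<open>0\<close>.\<close>

lemma hm_weight_prod_le:
  assumes "finite A" "\<And>i. i \<in> A \<Longrightarrow> p i \<noteq> 0"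
  shows "hm_weight (\<Prod>i\<in>A. p i) r \<le> (\<Sum>i\<in>A. hm_weight (p i) r)"
  using assms
proof (induction A rule: finite_induct)
  case empty
  then show ?case by (simp add: hm_weight_def mon_weight_def)
next
  case (insert x F)
  then have "(\<Prod>i\<in>F. p i) \<noteq> 0" by simp
  then have "hm_weight (p x * (\<Prod>i\<in>F. p i)) r \<le> hm_weight (p x) r + hm_weight (\<Prod>i\<in>F. p i) r"
    using insert.prems by (intro hm_weight_mult_le) auto
  with insert show ?case by fastforce
qed

section \<open>Necessary conditions\<close>

text \<open>The other two rows can be coordinate vectors, one of them divided by a nonzero entry of
  \<open>v\<close>; choosing them in cyclic order makes the determinant \<open>1\<close> rather than
  \<open>-1\<close>.\<close>

lemma SL3_with_first_row:
  fixes v :: "3 \<Rightarrow> complex"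
  assumes "v i \<noteq> 0"
  shows "\<exists>g\<in>SL3. \<forall>j. g $ 0 $ j = v j"
proof -
  have mk: "\<exists>g\<in>SL3. \<forall>j. g $ 0 $ j = v j"
    if "v 0 * (a 1 * b 2 - a 2 * b 1) - v 1 * (a 0 * b 2 - a 2 * b 0) + v 2 * (a 0 * b 1 - a 1 * b 0) = 1"
    for a b :: "3 \<Rightarrow> complex"
    using that
    by (intro bexI[of _ "\<chi> i j. if i = 0 then v j else if i = 1 then a j else b j"])
      (auto simp: SL3_def det_3')
  consider "v 0 \<noteq> 0" | "v 1 \<noteq> 0" | "v 2 \<noteq> 0"
    using assms forall_3'[of "\<lambda>i. v i = 0"] by blast
  then show ?thesis
  proof cases
    case 1
    then show ?thesis
      by (intro mk[of "\<lambda>j. if j = 1 then 1 / v 0 else 0" "\<lambda>j. if j = 2 then 1 else 0"]) simp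
  next
    case 2
    then show ?thesis
      by (intro mk[of "\<lambda>j. if j = 2 then 1 / v 1 else 0" "\<lambda>j. if j = 0 then 1 else 0"]) simp
  next
    case 3
    then show ?thesis
      by (intro mk[of "\<lambda>j. if j = 0 then 1 / v 2 else 0" "\<lambda>j. if j = 1 then 1 else 0"]) simp
  qed
qed

text \<open>If \<open>v\<close> is row \<open>0\<close> of \<open>g\<close>, then \<open>v\<close>
  times the inverse of \<open>g\<close> is row \<open>0\<close> of the identity matrix.\<close>

lemma exists_act_eq_Var_0:
  assumes "is_form 1 l"
  shows "\<exists>g\<in>SL3. act g l = Var 0"
proof -
  obtain v i where v: "l = lin v" "v i \<noteq> 0" using assms by (rule is_form_1_obtains)
  then obtain g where g: "g \<in> SL3" "\<And>j. g $ 0 $ j = v j" using SL3_with_first_row by metis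
  have "(\<Sum>k\<in>UNIV. v k * matrix_inv g $ k $ j) = (if 0 = j then 1 else 0)" for j
    using arg_cong[OF SL3_matrix_inv(1)[OF g(1)], of "\<lambda>A. A $ 0 $ j"] g(2)
    by (simp add: matrix_matrix_mult_def mat_def)
  then have "act g l = Var 0" by (simp add: v(1) act_lin Var_eq_lin)
  with g(1) show ?thesis ..
qed

definition line_weights :: "3 \<Rightarrow> int" where
  "line_weights i = (if i = 0 then 2 else -1)"

lemma normalized_line_weights: "normalized_1ps line_weights"
  unfolding normalized_1ps_def by (auto simp: line_weights_def)

lemma hm_weight_line_weights_ge:
  assumes "is_form d p"
  shows "- int d \<le> hm_weight p line_weights"
proof (rule hm_weight_ge)
  fix m assume "m \<in> Poly_Mapping.keys p"
  then have "mon_degree m = d" using assms by (simp add: is_form_def)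
  then have "int d = (\<Sum>i\<in>UNIV. int (Poly_Mapping.lookup m i))"
    by (simp add: mon_degree_def flip: of_nat_sum)
  then show "- int d \<le> mon_weight line_weights m"
    unfolding mon_weight_def sum_3' by (simp add: line_weights_def)
qed (use assms in \<open>simp add: is_form_def\<close>)

lemma hm_weight_Var_line_weights: "hm_weight (Var 0) line_weights = 2"
proof -
  have "Poly_Mapping.keys (Var 0) = {Poly_Mapping.single 0 1}"
    by (simp add: Var_def)
  then show ?thesis
    by (simp only: hm_weight_def image_insert image_empty mon_weight_single Min_singleton)
      (simp add: line_weights_def)
qed

text \<open>The same test is applied three times: with \<open>l1\<close>, with \<open>l2\<close>
  and, if \<open>d = 1\<close>, with the line \<open>f\<close> moved to \<open>Var 0\<close>. The
  moved form has weight \<open>2\<close>, each other form at least minus its degree.\<close>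

lemma Stab_necessary:
  assumes "(t1, t2) \<in> Stab d"
  shows "0 \<le> t1" "0 \<le> t2" "2 * t1 - t2 - of_nat d \<le> 0" "2 * t2 - t1 - of_nat d \<le> 0"
    and "d = 1 \<Longrightarrow> 2 \<le> t1 + t2"
proof -
  obtain f l1 l2 where f: "is_form d f" and l: "is_form 1 l1" "is_form 1 l2"
    and ss: "t_semistable (t1, t2) f l1 l2" and t: "0 \<le> t1" "0 \<le> t2"
    using assms by (auto simp: Stab_def)
  let ?\<mu> = "\<lambda>g p. rat_of_int (hm_weight (act g p) line_weights)"
  have sum: "?\<mu> g f + t1 * ?\<mu> g l1 + t2 * ?\<mu> g l2 \<le> 0" if "g \<in> SL3" for g
    using ss that normalized_line_weights by (simp add: t_semistable_def hm_weight_t_def)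
  have ge: "- of_nat e \<le> ?\<mu> g p" if "g \<in> SL3" "is_form e p" for g e p
    using hm_weight_line_weights_ge[OF is_form_act[OF that]] by linarith
  show "0 \<le> t1" "0 \<le> t2" by fact+
  obtain g where g: "g \<in> SL3" "act g l1 = Var 0" using exists_act_eq_Var_0[OF l(1)] by blast
  have "t2 * (-1) \<le> t2 * ?\<mu> g l2" using ge[OF g(1) l(2)] t by (intro mult_left_mono) auto
  with sum[OF g(1)] ge[OF g(1) f] show "2 * t1 - t2 - of_nat d \<le> 0"
    by (simp add: g(2) hm_weight_Var_line_weights)
  obtain g where g: "g \<in> SL3" "act g l2 = Var 0" using exists_act_eq_Var_0[OF l(2)] by blast
  have "t1 * (-1) \<le> t1 * ?\<mu> g l1" using ge[OF g(1) l(1)] t by (intro mult_left_mono) auto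
  with sum[OF g(1)] ge[OF g(1) f] show "2 * t2 - t1 - of_nat d \<le> 0"
    by (simp add: g(2) hm_weight_Var_line_weights)
  assume "d = 1"
  then obtain g where g: "g \<in> SL3" "act g f = Var 0" using exists_act_eq_Var_0 f by blast
  have "t1 * (-1) \<le> t1 * ?\<mu> g l1" "t2 * (-1) \<le> t2 * ?\<mu> g l2"
    using ge[OF g(1) l(1)] ge[OF g(1) l(2)] t by (intro mult_left_mono; simp)+
  with sum[OF g(1)] show "2 \<le> t1 + t2"
    by (simp add: g(2) hm_weight_Var_line_weights)
qed

section \<open>Lines in general position\<close>

text \<open>
  The lines are the points \<open>(1, k, k\<^sup>2)\<close> of a conic in the dual plane, no three of which are collinear.
\<close>

definition moment :: "nat \<Rightarrow> 3 \<Rightarrow> complex" where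
  "moment k i = (if i = 0 then 1 else if i = 1 then of_nat k else of_nat k ^ 2)"

text \<open>As a function of \<open>k\<close> this is a polynomial of degree at most 2 whose
  coefficients form column \<open>j\<close> of \<open>A\<close>; the lemmas below count its
  roots.\<close>

definition moment_coeff :: "complex^3^3 \<Rightarrow> nat \<Rightarrow> 3 \<Rightarrow> complex" where
  "moment_coeff A k j = A $ 0 $ j + of_nat k * A $ 1 $ j + of_nat k ^ 2 * A $ 2 $ j"

lemma act_lin_moment: "act g (lin (moment k)) = lin (moment_coeff (matrix_inv g) k)"
  by (simp add: act_lin sum_3' moment_def moment_coeff_def[abs_def])

text \<open>Vieta's formulas for a quadratic polynomial with the two roots \<open>k\<close> and
  \<open>l\<close>.\<close>

lemma moment_coeff_two_zeros:
  assumes "k \<noteq> l" "moment_coeff A k j = 0" "moment_coeff A l j = 0"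
  shows "A $ 1 $ j = - (of_nat k + of_nat l) * A $ 2 $ j" "A $ 0 $ j = of_nat k * of_nat l * A $ 2 $ j"
proof -
  have "(of_nat k - of_nat l) * (A $ 1 $ j + (of_nat k + of_nat l) * A $ 2 $ j) = 0"
    using assms(2,3) unfolding moment_coeff_def by algebra
  then show 1: "A $ 1 $ j = - (of_nat k + of_nat l) * A $ 2 $ j"
    using assms(1) by (simp add: eq_neg_iff_add_eq_0 del: minus_add_distrib)
  show "A $ 0 $ j = of_nat k * of_nat l * A $ 2 $ j"
    using assms(2) 1 unfolding moment_coeff_def by algebra
qed

text \<open>A quadratic polynomial with three roots vanishes, which would give \<open>A\<close> a
  zero column. Geometrically, at most two of the lines pass through the point (0:0:1).\<close>

lemma card_moment_coeff_2:
  assumes "det A \<noteq> 0" "finite S" "\<And>k. k \<in> S \<Longrightarrow> moment_coeff A k 2 = 0"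
  shows "card S \<le> 2"
proof (rule ccontr)
  assume "\<not> card S \<le> 2"
  then obtain T where "T \<subseteq> S" "card T = 3" by (metis not_less_eq_eq numeral_2_eq_2 numeral_3_eq_3 obtain_subset_with_card_n)
  then obtain k l m where klm: "k \<in> S" "l \<in> S" "m \<in> S" "k \<noteq> l" "k \<noteq> m" "l \<noteq> m"
    by (auto simp: card_3_iff)
  note kl = moment_coeff_two_zeros[OF klm(4) assms(3)[OF klm(1)] assms(3)[OF klm(2)]]
  note km = moment_coeff_two_zeros[OF klm(5) assms(3)[OF klm(1)] assms(3)[OF klm(3)]]
  have "(of_nat l - of_nat m) * A $ 2 $ 2 = 0" using kl(1) km(1) by algebra
  then have "A $ 2 $ 2 = 0" using klm(6) by simp
  with kl have "A $ 0 $ 2 = 0" "A $ 1 $ 2 = 0" by auto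
  with \<open>A $ 2 $ 2 = 0\<close> assms(1) show False by (simp add: det_3')
qed

text \<open>With two common roots \<open>k\<close> and \<open>l\<close>, columns \<open>1\<close>
  and \<open>2\<close> are both multiples of \<open>(k * l, - (k + l), 1)\<close>. Geometrically, at
  most one of the lines becomes \<open>x0 = 0\<close>.\<close>

lemma card_moment_coeff_12:
  assumes "det A \<noteq> 0" "finite S"
    and "\<And>k. k \<in> S \<Longrightarrow> moment_coeff A k 1 = 0" "\<And>k. k \<in> S \<Longrightarrow> moment_coeff A k 2 = 0"
  shows "card S \<le> 1"
proof (rule ccontr)
  assume "\<not> card S \<le> 1"
  then obtain T where "T \<subseteq> S" "card T = 2" by (metis not_less_eq_eq numeral_2_eq_2 One_nat_def obtain_subset_with_card_n)
  then obtain k l where kl: "k \<in> S" "l \<in> S" "k \<noteq> l"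
    by (auto simp: card_2_iff)
  note z1 = moment_coeff_two_zeros[OF kl(3) assms(3)[OF kl(1)] assms(3)[OF kl(2)]]
  note z2 = moment_coeff_two_zeros[OF kl(3) assms(4)[OF kl(1)] assms(4)[OF kl(2)]]
  have "det A = 0" unfolding det_3' z1 z2 by algebra
  with assms(1) show False ..
qed

text \<open>Otherwise row \<open>0\<close> of \<open>A\<close> would be a linear combination of the
  other two rows.\<close>

lemma moment_coeff_nonzero:
  assumes "det A \<noteq> 0"
  shows "\<exists>j. moment_coeff A k j \<noteq> 0"
proof (rule ccontr)
  assume "\<not> (\<exists>j. moment_coeff A k j \<noteq> 0)"
  then have z: "A $ 0 $ j = - (of_nat k * A $ 1 $ j + of_nat k ^ 2 * A $ 2 $ j)" for j
    unfolding moment_coeff_def by (simp add: eq_neg_iff_add_eq_0 add.assoc del: minus_add_distrib)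
  have "det A = 0" unfolding det_3' z by algebra
  with assms show False ..
qed

section \<open>Semistability of weighted lines\<close>

lemma normalized_1psD:
  assumes "normalized_1ps r"
  shows "r 0 + r 1 + r 2 = 0" "r 1 \<le> r 0" "r 2 \<le> r 1"
  using assms by (auto simp: normalized_1ps_def)

text \<open>Lines outside \<open>S1\<close> weigh at most \<open>r 2\<close>, those in
  \<open>S1\<close> at most \<open>r 1\<close>, except for those in \<open>S0\<close>, which is
  contained in \<open>S1\<close>, where the bound is \<open>r 0\<close>. As \<open>S1\<close>
  carries at most 2/3 and \<open>S0\<close> at most 1/3 of the total \<open>W\<close>, the sum is at
  most \<open>W / 3 * (r 0 + r 1 + r 2) = 0\<close>.\<close>

lemma weighted_lines_semistable:
  fixes w :: "nat \<Rightarrow> rat"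
  assumes "normalized_1ps r" "det A \<noteq> 0"
    and w: "\<And>k. k < n \<Longrightarrow> 0 \<le> w k" "\<And>k. k < n \<Longrightarrow> 3 * w k \<le> (\<Sum>k<n. w k)"
  shows "(\<Sum>k<n. w k * of_int (hm_weight (lin (moment_coeff A k)) r)) \<le> 0"
proof -
  note r = normalized_1psD[OF assms(1)]
  let ?W = "\<Sum>k<n. w k"
  define S1 where "S1 = {k\<in>{..<n}. moment_coeff A k 2 = 0}"
  define S0 where "S0 = {k\<in>{..<n}. moment_coeff A k 1 = 0 \<and> moment_coeff A k 2 = 0}"
  have W: "0 \<le> ?W" using w(1) by (intro sum_nonneg) simp
  have part: "3 * sum w S \<le> of_nat c * ?W" if "S \<subseteq> {..<n}" "card S \<le> c" for S c
  proof -
    have "3 * sum w S = (\<Sum>k\<in>S. 3 * w k)" by (simp add: sum_distrib_left)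
    also have "\<dots> \<le> of_nat (card S) * ?W" using that(1) w(2) by (intro sum_bounded_above) auto
    also have "\<dots> \<le> of_nat c * ?W" using that(2) W by (intro mult_right_mono) auto
    finally show ?thesis .
  qed
  have sub: "S0 \<subseteq> {..<n}" "S1 \<subseteq> {..<n}" by (auto simp: S0_def S1_def)
  have fin: "finite S0" "finite S1" by (simp_all add: S0_def S1_def)
  have "card S1 \<le> 2" by (rule card_moment_coeff_2[OF assms(2) fin(2)]) (simp add: S1_def)
  from part[OF sub(2) this] have 1: "3 * sum w S1 \<le> 2 * ?W" by simp
  have "card S0 \<le> 1" by (rule card_moment_coeff_12[OF assms(2) fin(1)]) (simp_all add: S0_def)
  from part[OF sub(1) this] have 0: "3 * sum w S0 \<le> ?W" by simp
  \<comment> \<open>The bound is written with the nonnegative increments \<open>r 1 - r 2\<close>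
    and \<open>r 0 - r 1\<close>, so that upper bounds for the weights of \<open>S1\<close> and
    \<open>S0\<close> can be inserted after summation.\<close>
  have bound: "hm_weight (lin (moment_coeff A k)) r \<le>
      r 2 + (if k \<in> S1 then r 1 - r 2 else 0) + (if k \<in> S0 then r 0 - r 1 else 0)" if "k < n" for k
  proof -
    consider "moment_coeff A k 2 \<noteq> 0" | "moment_coeff A k 2 = 0" "moment_coeff A k 1 \<noteq> 0"
      | "moment_coeff A k 2 = 0" "moment_coeff A k 1 = 0" "moment_coeff A k 0 \<noteq> 0"
      using moment_coeff_nonzero[OF assms(2), of k] forall_3'[of "\<lambda>j. moment_coeff A k j = 0"] by blast
    then show ?thesis
    proof cases
      case 1
      then show ?thesis using hm_weight_lin_le[of "moment_coeff A k" 2 r] 1 r by (simp add: S0_def S1_def)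
    next
      case 2
      then show ?thesis using hm_weight_lin_le[of "moment_coeff A k" 1 r] 2 r that by (simp add: S0_def S1_def)
    next
      case 3
      then show ?thesis using hm_weight_lin_le[of "moment_coeff A k" 0 r] 3 r that by (simp add: S0_def S1_def)
    qed
  qed
  have "(\<Sum>k<n. w k * of_int (hm_weight (lin (moment_coeff A k)) r)) \<le>
      (\<Sum>k<n. w k * of_int (r 2 + (if k \<in> S1 then r 1 - r 2 else 0) + (if k \<in> S0 then r 0 - r 1 else 0)))"
    using bound w(1) by (intro sum_mono mult_left_mono) (simp_all only: of_int_le_iff lessThan_iff)
  also have "\<dots> = (\<Sum>k<n. w k * of_int (r 2) + (if k \<in> S1 then w k * of_int (r 1 - r 2) else 0) +
      (if k \<in> S0 then w k * of_int (r 0 - r 1) else 0))"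
    by (intro sum.cong refl) (simp add: distrib_left del: of_int_diff)
  also have "\<dots> = ?W * of_int (r 2) + sum w S1 * of_int (r 1 - r 2) + sum w S0 * of_int (r 0 - r 1)"
  proof -
    have *: "(\<Sum>k<n. if k \<in> S then w k * c else 0) = sum w S * c" if "S \<subseteq> {..<n}" for S c
      using that by (simp add: sum.If_cases sum_distrib_right Int_absorb1)
    show ?thesis by (simp only: sum.distrib *[OF sub(1)] *[OF sub(2)] sum_distrib_right)
  qed
  also have "\<dots> \<le> ?W * of_int (r 2) + (2 / 3 * ?W) * of_int (r 1 - r 2) + (1 / 3 * ?W) * of_int (r 0 - r 1)"
    using 0 1 r(2,3) by (intro add_mono mult_right_mono order_refl) simp_all
  also have "\<dots> = ?W / 3 * of_int (r 0 + r 1 + r 2)" by (simp add: field_simps)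
  also have "\<dots> = 0" by (simp only: r of_int_0 mult_zero_right)
  finally show ?thesis .
qed

text \<open>The last three hypotheses say that three times each of the weights \<open>t1\<close>,
  \<open>t2\<close> and \<open>1\<close> is at most the total weight \<open>d + t1 + t2\<close>. The
  numbers \<open>d\<close> and \<open>Suc d\<close> continue the family of lines used in
  \<open>f\<close>.\<close>

lemma Stab_lines:
  assumes "0 \<le> t1" "0 \<le> t2" "2 * t1 - t2 \<le> of_nat d" "2 * t2 - t1 \<le> of_nat d" "3 \<le> of_nat d + t1 + t2"
  shows "(t1, t2) \<in> Stab d"
proof -
  let ?f = "\<Prod>k<d. lin (moment k)"
  define w where "w k = (if k < d then 1 else if k = d then t1 else t2)" for k
  have form: "is_form 1 (lin (moment k))" for k
    by (rule is_form_lin[of _ 0]) (simp add: moment_def)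
  then have "is_form d ?f"
    using homog_prod[of "{..<d}" "\<lambda>_. 1" "\<lambda>k. lin (moment k)"] by (simp add: is_form_iff)
  moreover have "t_semistable (t1, t2) ?f (lin (moment d)) (lin (moment (Suc d)))"
    unfolding t_semistable_def
  proof (intro ballI allI impI)
    fix g r assume g: "g \<in> SL3" and r: "normalized_1ps r"
    let ?A = "matrix_inv g"
    let ?\<mu> = "\<lambda>k. hm_weight (lin (moment_coeff ?A k)) r"
    have det: "det ?A \<noteq> 0" using SL3_matrix_inv(3)[OF g] by simp
    have "lin (moment_coeff ?A k) \<noteq> 0" for k
      using moment_coeff_nonzero[OF det] lin_eq_0_iff by blast
    then have "hm_weight (act g ?f) r \<le> (\<Sum>k<d. ?\<mu> k)"
      unfolding act_prod act_lin_moment by (intro hm_weight_prod_le) auto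
    then have "rat_of_int (hm_weight (act g ?f) r) \<le> of_int (\<Sum>k<d. ?\<mu> k)"
      by (simp only: of_int_le_iff)
    then have "hm_weight_t (t1, t2) (act g ?f) (act g (lin (moment d))) (act g (lin (moment (Suc d)))) r \<le>
        (\<Sum>k<d. of_int (?\<mu> k)) + t1 * of_int (?\<mu> d) + t2 * of_int (?\<mu> (Suc d))"
      by (simp add: hm_weight_t_def act_lin_moment)
    also have "\<dots> = (\<Sum>k<Suc (Suc d). w k * of_int (?\<mu> k))"
      by (simp add: w_def)
    also have "\<dots> \<le> 0"
      using assms by (intro weighted_lines_semistable r det) (auto simp: w_def)
    finally show "hm_weight_t (t1, t2) (act g ?f) (act g (lin (moment d))) (act g (lin (moment (Suc d)))) r \<le> 0" .
  qed
  ultimately show ?thesis using assms form by (auto simp: Stab_def)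
qed

section \<open>A smooth conic and a transversal line\<close>

lemma single_add_single_eq_iff:
  "Poly_Mapping.single i (1::nat) + Poly_Mapping.single j 1 =
     Poly_Mapping.single k 1 + Poly_Mapping.single l 1 \<longleftrightarrow> i = k \<and> j = l \<or> i = l \<and> j = k"
  (is "?L \<longleftrightarrow> ?R")
proof
  assume eq: ?L
  show ?R
  proof (cases "i = k")
    case True
    with eq show ?thesis by (simp add: single_1_eq_iff del: One_nat_def)
  next
    case False
    have "Poly_Mapping.lookup (Poly_Mapping.single i (1::nat) + Poly_Mapping.single j 1) i =
        Poly_Mapping.lookup (Poly_Mapping.single k 1 + Poly_Mapping.single l 1) i"
      using eq by simp
    with False have "i = l" by (auto simp: lookup_add lookup_single when_def split: if_splits)
    with eq show ?thesis by (simp add: single_1_eq_iff add.commute del: One_nat_def)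
  qed
qed (auto simp: add.commute)

lemma lookup_lin_mult_lin:
  "Poly_Mapping.lookup (lin a * lin b) (Poly_Mapping.single i 1 + Poly_Mapping.single j 1) =
     (if i = j then a i * b i else a i * b j + a j * b i)"
proof -
  have "Poly_Mapping.lookup (lin a * lin b) (Poly_Mapping.single i 1 + Poly_Mapping.single j 1) =
      (\<Sum>k\<in>UNIV. \<Sum>l\<in>UNIV. a k * b l when (k = i \<and> l = j \<or> k = j \<and> l = i))"
    by (simp add: lin_eq_single sum_product mult_single lookup_sum lookup_single
        single_add_single_eq_iff del: One_nat_def)
  \<comment> \<open>The pairs \<open>(i, j)\<close> and \<open>(j, i)\<close> are separated; the
    inner test \<open>i = j\<close> keeps the diagonal pair from being counted twice.\<close>
  also have "\<dots> = (\<Sum>k\<in>UNIV. \<Sum>l\<in>UNIV. (if l = j then if k = i then a i * b j else 0 else 0) +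
      (if l = i then if k = j then if i = j then 0 else a j * b i else 0 else 0))"
    by (intro sum.cong refl) (auto simp: when_def)
  also have "\<dots> = (if i = j then a i * b i else a i * b j + a j * b i)"
    by (simp add: sum.distrib)
  finally show ?thesis .
qed

text \<open>
  The discriminant of the conic \<open>a b + c\<^sup>2\<close> is minus the square of the determinant of the three
  linear forms \<open>a\<close>, \<open>b\<close>, \<open>c\<close>; two of the six coefficients vanish here.
\<close>

lemma conic_discriminant:
  fixes a0 :: "'a::idom"
  assumes "a2 * b2 + c2 ^ 2 = 0" "a1 * b2 + a2 * b1 + 2 * c1 * c2 = 0"
  shows "(a1 * b1 + c1 ^ 2) * (a0 * b2 + a2 * b0 + 2 * c0 * c2) ^ 2 =
    (a0 * (b1 * c2 - b2 * c1) - a1 * (b0 * c2 - b2 * c0) + a2 * (b0 * c1 - b1 * c0)) ^ 2"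
proof -
  define A00 A01 where "A00 = a0 * b0 + c0 ^ 2" and "A01 = a0 * b1 + a1 * b0 + 2 * c0 * c1"
  \<comment> \<open>This identity holds without the hypotheses: the right-hand side is -4 times the
    determinant of the symmetric matrix of the conic, arranged so that the last two summands contain
    the vanishing coefficients.\<close>
  have "(a0 * (b1 * c2 - b2 * c1) - a1 * (b0 * c2 - b2 * c0) + a2 * (b0 * c1 - b1 * c0)) ^ 2 =
    (a1 * b1 + c1 ^ 2) * (a0 * b2 + a2 * b0 + 2 * c0 * c2) ^ 2 +
    (a2 * b2 + c2 ^ 2) * (A01 ^ 2 - 4 * A00 * (a1 * b1 + c1 ^ 2)) +
    (a1 * b2 + a2 * b1 + 2 * c1 * c2) *
      (A00 * (a1 * b2 + a2 * b1 + 2 * c1 * c2) - A01 * (a0 * b2 + a2 * b0 + 2 * c0 * c2))"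
    unfolding A00_def A01_def by algebra
  with assms show ?thesis by simp
qed

text \<open>The total weight is a convex combination of its values for \<open>t1 + t2 = 0\<close>
  and \<open>t1 + t2 = 1\<close>, so only these two extreme cases have to be bounded. The line
  \<open>Var 2\<close> meets the conic in two distinct points, hence is nowhere tangent to
  it.\<close>

lemma Stab_conic:
  assumes "0 \<le> t1" "0 \<le> t2" "t1 + t2 \<le> 1"
  shows "(t1, t2) \<in> Stab 2"
proof -
  let ?f = "Var 0 * Var 1 + Var 2 ^ 2"
  let ?e = "\<lambda>i j. Poly_Mapping.single i 1 + Poly_Mapping.single j (1::nat) :: monomial"
  have "homog 2 ?f"
    using homog_add[of 2 "Var 0 * Var 1" "Var 2 ^ 2"] homog_mult[of 1 "Var 0" 1 "Var 1"]
      homog_power[of 1 "Var 2" 2] is_form_Var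
    by (simp add: is_form_iff numeral_2_eq_2)
  moreover have "Poly_Mapping.lookup ?f (?e 2 2) = 1"
    unfolding Var_eq_lin power2_eq_square lookup_add lookup_lin_mult_lin by simp
  then have "?f \<noteq> 0" by auto
  ultimately have "is_form 2 ?f" by (simp add: is_form_iff)
  moreover have "t_semistable (t1, t2) ?f (Var 2) (Var 2)"
    unfolding t_semistable_def
  proof (intro ballI allI impI)
    fix g r assume g: "g \<in> SL3" and nr: "normalized_1ps r"
    note r = normalized_1psD[OF nr]
    let ?a = "\<lambda>j. matrix_inv g $ 0 $ j" and ?b = "\<lambda>j. matrix_inv g $ 1 $ j"
      and ?c = "\<lambda>j. matrix_inv g $ 2 $ j"
    define q where "q i j = (if i = j then ?a i * ?b i + ?c i ^ 2
      else ?a i * ?b j + ?a j * ?b i + 2 * ?c i * ?c j)" for i j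
    have det: "?a 0 * (?b 1 * ?c 2 - ?b 2 * ?c 1) - ?a 1 * (?b 0 * ?c 2 - ?b 2 * ?c 0) +
        ?a 2 * (?b 0 * ?c 1 - ?b 1 * ?c 0) = 1"
      using SL3_matrix_inv(3)[OF g] by (simp add: det_3')
    have act_f: "act g ?f = lin ?a * lin ?b + lin ?c * lin ?c"
      by (simp add: act_add act_mult act_power act_Var power2_eq_square)
    have \<mu>f: "hm_weight (act g ?f) r \<le> r i + r j" if "q i j \<noteq> 0" for i j
    proof -
      have "Poly_Mapping.lookup (act g ?f) (?e i j) = q i j"
        unfolding act_f lookup_add lookup_lin_mult_lin q_def by (simp add: power2_eq_square)
      then have "?e i j \<in> Poly_Mapping.keys (act g ?f)" using that by (simp add: in_keys_iff)
      from hm_weight_le[OF this, of r] show ?thesis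
        by (simp add: mon_weight_add mon_weight_single del: One_nat_def)
    qed
    have \<mu>l: "hm_weight (act g (Var 2)) r \<le> r i" if "?c i \<noteq> 0" for i
      unfolding act_Var using that by (rule hm_weight_lin_le)
    have "?c 0 \<noteq> 0 \<or> ?c 1 \<noteq> 0 \<or> ?c 2 \<noteq> 0" using det by auto
    then have l0: "hm_weight (act g (Var 2)) r \<le> r 0"
      using \<mu>l[of 0] \<mu>l[of 1] \<mu>l[of 2] r(2,3) by fastforce
    have f0: "hm_weight (act g ?f) r \<le> 0 \<and> hm_weight (act g ?f) r + hm_weight (act g (Var 2)) r \<le> 0"
    \<comment> \<open>Here \<open>q i j\<close> is the coefficient of \<open>x_i x_j\<close> in the
      moved conic. The condition says that the conic passes through (0:0:1) and, being smooth, has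
      the tangent \<open>x0 = 0\<close> there.\<close>
    proof (cases "q 2 2 = 0 \<and> q 1 2 = 0")
      case False
      then have "hm_weight (act g ?f) r \<le> r 1 + r 2" using \<mu>f[of 2 2] \<mu>f[of 1 2] r(3) by fastforce
      then show ?thesis using l0 r by linarith
    next
      case True
      then have q: "?a 2 * ?b 2 + ?c 2 ^ 2 = 0" "?a 1 * ?b 2 + ?a 2 * ?b 1 + 2 * ?c 1 * ?c 2 = 0"
        by (simp_all add: q_def)
      have "q 1 1 * q 0 2 ^ 2 = 1"
        unfolding q_def using conic_discriminant[OF q] det by simp
      then have "q 1 1 \<noteq> 0" "q 0 2 \<noteq> 0" by (metis mult_zero_left zero_neq_one,
          metis mult_zero_right zero_neq_one zero_power2)
      note f = \<mu>f[OF this(1)] \<mu>f[OF this(2)]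
      \<comment> \<open>Otherwise the moved line would be \<open>x0 = 0\<close>, the tangent of the
        conic at (0:0:1).\<close>
      have "\<not> (?c 1 = 0 \<and> ?c 2 = 0)"
      proof
        assume c: "?c 1 = 0 \<and> ?c 2 = 0"
        then have "?a 2 = 0 \<or> ?b 2 = 0" using q(1) by simp
        with c have "?a 1 * ?b 2 = 0 \<and> ?a 2 * ?b 1 = 0" using q(2) by auto
        then show False using det c by auto
      qed
      then have "hm_weight (act g (Var 2)) r \<le> r 1" using \<mu>l[of 1] \<mu>l[of 2] r(3) by fastforce
      \<comment> \<open>The conic weighs at most \<open>2 * r 1\<close> and at most
        \<open>r 0 + r 2 = - r 1\<close>. One of these bounds is at most \<open>0\<close>, and the
        second cancels the bound \<open>r 1\<close> for the line.\<close>
      with f r show ?thesis by linarith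
    qed
    let ?F = "rat_of_int (hm_weight (act g ?f) r)" and ?L = "rat_of_int (hm_weight (act g (Var 2)) r)"
    have F: "?F \<le> 0" "?F + ?L \<le> 0" using f0 by (simp_all flip: of_int_add)
    have "?F + t1 * ?L + t2 * ?L = (1 - (t1 + t2)) * ?F + (t1 + t2) * (?F + ?L)"
      by (simp add: algebra_simps)
    also have "\<dots> \<le> 0"
      using F assms by (intro add_nonpos_nonpos[OF mult_nonneg_nonpos mult_nonneg_nonpos]) simp_all
    finally show "hm_weight_t (t1, t2) (act g ?f) (act g (Var 2)) (act g (Var 2)) r \<le> 0"
      by (simp add: hm_weight_t_def)
  qed
  ultimately show ?thesis
    unfolding Stab_def mem_Collect_eq prod.case using assms(1,2) is_form_Var[of 2] by blast
qed

text \<open>Degree 1 is stated apart because there the curve is a line too: the extra condition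
  \<open>2 <= t1 + t2\<close> cuts the region given by the four inequalities down to the point
  \<open>(1, 1)\<close>.\<close>

theorem lemma2p9:
  fixes d :: nat
  assumes "d \<ge> 1"
  shows "(d \<ge> 2 \<longrightarrow>
            Stab d = {(t1, t2). 2 * t1 - t2 - of_nat d \<le> 0 \<and> 2 * t2 - t1 - of_nat d \<le> 0 \<and>
                                0 \<le> t1 \<and> 0 \<le> t2}) \<and>
         (d = 1 \<longrightarrow> Stab d = {(1, 1)}) \<and>
         (1, 1) \<in> Stab d"
proof (intro conjI impI)
  have "1 \<le> rat_of_nat d" using assms by simp
  \<comment> \<open>At \<open>(1, 1)\<close> all \<open>d + 2\<close> lines have weight
    \<open>1\<close>, and the total is at least \<open>3\<close>.\<close>
  then show one: "(1, 1) \<in> Stab d" by (intro Stab_lines) auto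
  show "Stab d = {(1, 1)}" if "d = 1"
  proof -
    have "(t1, t2) = (1, 1)" if "(t1, t2) \<in> Stab d" for t1 t2
      using Stab_necessary(3-5)[OF that] \<open>d = 1\<close> by simp
    with one show ?thesis by (intro subset_antisym subrelI) simp_all
  qed
  assume d: "d \<ge> 2"
  have suff: "(t1, t2) \<in> Stab d"
    if t: "2 * t1 - t2 - of_nat d \<le> 0" "2 * t2 - t1 - of_nat d \<le> 0" "0 \<le> t1" "0 \<le> t2" for t1 t2
  proof (cases "3 \<le> of_nat d + t1 + t2")
    case True
    then show ?thesis using t by (intro Stab_lines) auto
  next
    case False
    then have "rat_of_nat d < of_nat 3" using t by simp
    then have "d = 2" using d by (simp only: of_nat_less_iff)
    then show ?thesis using False t Stab_conic by simp
  qed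
  show "Stab d = {(t1, t2). 2 * t1 - t2 - of_nat d \<le> 0 \<and> 2 * t2 - t1 - of_nat d \<le> 0 \<and>
      0 \<le> t1 \<and> 0 \<le> t2}" (is "_ = ?P")
  proof (intro subset_antisym subrelI)
    show "(t1, t2) \<in> ?P" if "(t1, t2) \<in> Stab d" for t1 t2
      unfolding mem_Collect_eq prod.case using Stab_necessary(1-4)[OF that] by (intro conjI)
    show "(t1, t2) \<in> Stab d" if "(t1, t2) \<in> ?P" for t1 t2
      using that unfolding mem_Collect_eq prod.case by (elim conjE) (rule suff)
  qed
qed

end
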